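(* Let $\tilde{\mathfrak{g}}$ be a Lie algebra over $\mathbb{K}\in\{\mathbb{R},\mathbb{C}\}$ generated by its finite-dimensional subspace $$V_1(\tilde{\mathfrak{g}})=\mathfrak{g}_0\oplus\mathfrak{g}_1,$$ where $\mathfrak{g}_0$ is an abelian subalgebra of $\tilde{\mathfrak{g}}$ and the subspace $\mathfrak{g}_1$ is invariant under the (adjoint) $\mathfrak{g}_0$-action on $\tilde{\mathfrak{g}}$. Assume also that the $\mathfrak{g}_0$-module $\mathfrak{g}_1$ is diagonalizable and that the corresponding weights (roots) $\alpha_1,\dots,\alpha_q\in\mathfrak{g}_0^*$ are non-zero. Let $\mathfrak{g}$ be the subalgebra generated by the subspace $V_1(\mathfrak{g})=\mathfrak{g}_1$. Then the growth functions $F_{\mathfrak{g}}(n)$, $F_{\tilde{\mathfrak{g}}}(n)$ of the Lie algebras $\mathfrak{g}$ and $\tilde{\mathfrak{g}}$ are related by $$F_{\tilde{\mathfrak{g}}}(n)=F_{\mathfrak{g}}(n)+\dim\mathfrak{g}_0.$$ Hence $\mathfrak{g}$ and $\tilde{\mathfrak{g}}$ have equal Gelfand-Kirillov dimensions: $\mathrm{GKdim}\,\tilde{\mathfrak{g}}=\mathrm{GKdim}\,\mathfrak{g}$.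
   Context: For a Lie algebra $\mathfrak{g}$ generated by a finite-dimensional subspace $V_1(\mathfrak{g})$, let $V_n(\mathfrak{g})$, $n>1$, be the $\mathbb{K}$-linear span of all products of elements of $V_1(\mathfrak{g})$ of length at most $n$ with arbitrary arrangements of brackets. The growth function is $F_{\mathfrak{g}}(n)=\dim V_n(\mathfrak{g})$ (here taken with respect to the generating subspaces $V_1(\mathfrak{g})$ and $V_1(\tilde{\mathfrak{g}})$ named in the claim), and the Gelfand-Kirillov dimension is $$\mathrm{GKdim}\,\mathfrak{g}=\limsup_{n\to+\infty}\frac{\log\dim V_n(\mathfrak{g})}{\log n}$$ (equal to $0$ if $\mathfrak{g}$ is finite-dimensional).
   Formalization: The growth identity is proved under the added condition that 𝔤₀ meets 𝔤 only in 0; without it, it fails, e.g. for sl₂ with 𝔤₀=⟨h⟩, 𝔤₁=⟨e,f⟩, n=2 (3 versus 4). The equality of Gelfand-Kirillov dimensions is proved without this condition. *)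

theory Defs
  imports Complex_Main "HOL-Library.Extended_Real"
begin

text \<open>The definitions make sense over any field. The ground field "real or complex" is rendered
  by the type class \<open>real_normed_field\<close>: its norm is multiplicative, so by Gelfand-Mazur
  the real and the complex numbers are, up to isomorphism, its only instances.\<close>

locale lie_algebra = vector_space scale
  for scale :: "'k::field \<Rightarrow> 'a::ab_group_add \<Rightarrow> 'a" (infixr "*s" 75) +
  fixes bracket :: "'a \<Rightarrow> 'a \<Rightarrow> 'a"
  assumes bracket_add_left: "bracket (x + y) z = bracket x z + bracket y z"
    and bracket_add_right: "bracket x (y + z) = bracket x y + bracket x z"
    and bracket_scale_left: "bracket (c *s x) y = c *s bracket x y"
    and bracket_scale_right: "bracket x (c *s y) = c *s bracket x y"
    and bracket_self: "bracket x x = 0"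
    and jacobi: "bracket x (bracket y z) + bracket y (bracket z x) + bracket z (bracket x y) = 0"
begin

definition finite_dim :: "'a set \<Rightarrow> bool" where
  "finite_dim S \<longleftrightarrow> (\<exists>B. finite B \<and> S \<subseteq> span B)"

definition direct_sum_of :: "'a set \<Rightarrow> 'a set \<Rightarrow> 'a set \<Rightarrow> bool" where
  "direct_sum_of V U W \<longleftrightarrow>
     subspace U \<and> subspace W \<and> U \<inter> W = {0} \<and> V = {u + w | u w. u \<in> U \<and> w \<in> W}"

definition subalgebra :: "'a set \<Rightarrow> bool" where
  "subalgebra S \<longleftrightarrow> subspace S \<and> (\<forall>x\<in>S. \<forall>y\<in>S. bracket x y \<in> S)"

definition abelian_subalgebra :: "'a set \<Rightarrow> bool" where
  "abelian_subalgebra S \<longleftrightarrow> subalgebra S \<and> (\<forall>x\<in>S. \<forall>y\<in>S. bracket x y = 0)"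

definition generated_subalgebra :: "'a set \<Rightarrow> 'a set" where
  "generated_subalgebra S = subalgebra hull S"

definition ad_invariant :: "'a set \<Rightarrow> 'a set \<Rightarrow> bool" where
  "ad_invariant H M \<longleftrightarrow> (\<forall>h\<in>H. \<forall>x\<in>M. bracket h x \<in> M)"

text \<open>Elements of the dual space of a subspace \<open>H\<close> are represented by functions on the
  whole type; their values outside \<open>H\<close> are never used.\<close>

definition functional_on :: "'a set \<Rightarrow> ('a \<Rightarrow> 'k) \<Rightarrow> bool" where
  "functional_on H \<alpha> \<longleftrightarrow>
     (\<forall>x\<in>H. \<forall>y\<in>H. \<alpha> (x + y) = \<alpha> x + \<alpha> y) \<and> (\<forall>c. \<forall>x\<in>H. \<alpha> (c *s x) = c * \<alpha> x)"

definition weight_space :: "'a set \<Rightarrow> 'a set \<Rightarrow> ('a \<Rightarrow> 'k) \<Rightarrow> 'a set" where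
  "weight_space H M \<alpha> = {x \<in> M. \<forall>h\<in>H. bracket h x = \<alpha> h *s x}"

definition is_weight :: "'a set \<Rightarrow> 'a set \<Rightarrow> ('a \<Rightarrow> 'k) \<Rightarrow> bool" where
  "is_weight H M \<alpha> \<longleftrightarrow> functional_on H \<alpha> \<and> (\<exists>x\<in>weight_space H M \<alpha>. x \<noteq> 0)"

text \<open>The \<open>H\<close>-module \<open>M\<close> has a basis of simultaneous eigenvectors.\<close>

definition diagonalizable_module :: "'a set \<Rightarrow> 'a set \<Rightarrow> bool" where
  "diagonalizable_module H M \<longleftrightarrow>
     (\<exists>B. independent B \<and> span B = M \<and>
          (\<forall>b\<in>B. \<exists>\<alpha>. functional_on H \<alpha> \<and> b \<in> weight_space H M \<alpha>))"

text \<open>\<open>lie_product S m x\<close>: \<open>x\<close> is a product of \<open>m\<close> elements of \<open>S\<close> for some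
  arrangement of brackets.\<close>

inductive lie_product :: "'a set \<Rightarrow> nat \<Rightarrow> 'a \<Rightarrow> bool" for S :: "'a set" where
  generator: "x \<in> S \<Longrightarrow> lie_product S 1 x"
| product: "lie_product S i x \<Longrightarrow> lie_product S j y \<Longrightarrow> lie_product S (i + j) (bracket x y)"

text \<open>\<open>S\<close> is the generating subspace. Brackets in the generated subalgebra agree with the ambient
  ones, so growth function and dimension of that subalgebra are computed in the ambient algebra.\<close>

definition growth_space :: "'a set \<Rightarrow> nat \<Rightarrow> 'a set" where
  "growth_space S n = span {x. \<exists>m\<le>n. lie_product S m x}"

definition growth :: "'a set \<Rightarrow> nat \<Rightarrow> nat" where
  "growth S n = dim (growth_space S n)"

text \<open>The value may be \<open>\<infinity>\<close>. Since \<open>ln 0 = 0\<close>, the zero algebra gets dimension \<open>0\<close>, like every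
  other finite-dimensional algebra.\<close>

definition gk_dim :: "'a set \<Rightarrow> ereal" where
  "gk_dim S = limsup (\<lambda>n. ereal (ln (real (growth S n)) / ln (real n)))"

end

end

theory Submission
  imports Defs "HOL-Analysis.Extended_Real_Limits"
begin

text \<open>Why adjoining \<open>g0\<close> to the generators costs only the constant \<open>dim g0\<close>: a bracket with an
  element \<open>h\<close> of \<open>g0\<close> never makes a product longer. Indeed \<open>bracket h\<close> is a derivation that maps
  \<open>g1\<close> to itself, so it replaces one generator in a product by another element of \<open>g1\<close> and keeps
  the length; hence \<open>g0\<close> acts on each \<open>growth_space g1 n\<close> (\<open>growth_space_ad_invariant\<close>).
  Expanding a product of elements of \<open>g0 + g1\<close>, the part inside \<open>g0\<close> vanishes because \<open>g0\<close> is
  abelian, the mixed parts stay in the growth space of \<open>g1\<close>, and what remains is a product of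
  elements of \<open>g1\<close>. Hence \<open>growth_space V1 n\<close> is the sum of \<open>g0\<close> and \<open>growth_space g1 n\<close> for
  \<open>n \<ge> 1\<close> (\<open>growth_space_direct_sum\<close>).

  If \<open>g0\<close> meets the subalgebra generated by \<open>g1\<close> only in \<open>0\<close>, the sum is direct and dimensions
  add. In general they satisfy
  \<open>growth g1 n \<le> growth V1 n \<le> growth g1 n + dim g0\<close>. A bounded additive error changes the logarithm
  by a bounded amount, which disappears after division by \<open>ln n\<close>; so the two Gelfand-Kirillov
  dimensions agree.\<close>

section \<open>Dimensions of sums of finite-dimensional subspaces\<close>

context lie_algebra
begin

lemma finite_dim_subset: "finite_dim T \<Longrightarrow> S \<subseteq> T \<Longrightarrow> finite_dim S"
  unfolding finite_dim_def by blast

lemma finite_dim_basis: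
  assumes "finite_dim V"
  obtains B where "finite B" "B \<subseteq> V" "independent B" "V \<subseteq> span B" "card B = dim V"
proof -
  obtain A where A: "finite A" "V \<subseteq> span A"
    using assms unfolding finite_dim_def by blast
  obtain B where B: "B \<subseteq> V" "independent B" "V \<subseteq> span B" "card B = dim V"
    using basis_exists by blast
  have "finite B"
    using independent_span_bound[OF A(1) B(2)] A(2) B(1) by blast
  then show thesis
    using B that by blast
qed

text \<open>Monotonicity fails without finiteness: an infinite basis has \<open>card\<close> zero, so an
  infinite-dimensional space has \<open>dim\<close> zero.\<close>

lemma dim_mono_finite_dim:
  assumes "finite_dim V" "U \<subseteq> V"
  shows "dim U \<le> dim V"
proof -
  obtain B where "finite B" "V \<subseteq> span B" "card B = dim V"
    using finite_dim_basis[OF assms(1)] by metis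
  then show ?thesis
    using dim_le_card[of U B] assms(2) by auto
qed

lemma sum_subset_span_Un:
  assumes "U \<subseteq> span A" "W \<subseteq> span B"
  shows "{u + w | u w. u \<in> U \<and> w \<in> W} \<subseteq> span (A \<union> B)"
  using assms unfolding span_Un by blast

lemma dim_sum_le:
  assumes "finite_dim U" "finite_dim W"
  shows "dim {u + w | u w. u \<in> U \<and> w \<in> W} \<le> dim U + dim W"
proof -
  obtain A where A: "finite A" "U \<subseteq> span A" "card A = dim U"
    using finite_dim_basis[OF assms(1)] by metis
  obtain B where B: "finite B" "W \<subseteq> span B" "card B = dim W"
    using finite_dim_basis[OF assms(2)] by metis
  have "dim {u + w | u w. u \<in> U \<and> w \<in> W} \<le> card (A \<union> B)"
    using dim_le_card[OF sum_subset_span_Un[OF A(2) B(2)]] A(1) B(1) by simp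
  also have "\<dots> \<le> card A + card B"
    by (rule card_Un_le)
  finally show ?thesis
    using A(3) B(3) by simp
qed

text \<open>If \<open>a = u + w\<close> with \<open>a\<close> and \<open>u\<close> in \<open>U\<close>, then \<open>w\<close> lies in \<open>U \<inter> W = {0}\<close>; so any linear
  dependence in \<open>A \<union> B\<close> is already one inside \<open>A\<close> or inside \<open>B\<close>.\<close>

lemma not_in_span_Un_complementary:
  assumes "subspace U" "subspace W" "U \<inter> W = {0}"
    and "A \<subseteq> U" "B \<subseteq> W" "independent A" "a \<in> A"
  shows "a \<notin> span ((A - {a}) \<union> B)"
proof
  assume "a \<in> span ((A - {a}) \<union> B)"
  then obtain u w where uw: "a = u + w" "u \<in> span (A - {a})" "w \<in> span B"
    unfolding span_Un by blast
  have "u \<in> U"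
    using uw(2) span_minimal[OF _ assms(1), of "A - {a}"] assms(4) by blast
  moreover have "w \<in> W"
    using uw(3) span_minimal[OF assms(5,2)] by blast
  moreover have "w = a - u"
    using uw(1) by simp
  ultimately have "w \<in> U \<inter> W"
    using assms(1,4,7) subspace_diff by blast
  then have "a = u"
    using uw(1) assms(3) by simp
  then show False
    using uw(2) assms(6,7) unfolding dependent_def by blast
qed

lemma independent_Un_complementary:
  assumes "subspace U" "subspace W" "U \<inter> W = {0}"
    and "A \<subseteq> U" "B \<subseteq> W" "independent A" "independent B"
  shows "independent (A \<union> B)"
proof
  assume "dependent (A \<union> B)"
  then obtain a where a: "a \<in> A \<union> B" "a \<in> span (A \<union> B - {a})"
    unfolding dependent_def by blast
  have "a \<in> span ((A - {a}) \<union> B)"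
    by (rule subsetD[OF span_mono a(2)]) blast
  moreover have "a \<in> span ((B - {a}) \<union> A)"
    by (rule subsetD[OF span_mono a(2)]) blast
  moreover have "W \<inter> U = {0}"
    using assms(3) by (simp add: Int_commute)
  note not_in_span_Un_complementary[OF assms(1-6), of a]
    not_in_span_Un_complementary[OF assms(2,1) this assms(5,4,7), of a]
  ultimately show False
    using a(1) by auto
qed

lemma dim_direct_sum:
  assumes "direct_sum_of V U W" "finite_dim U" "finite_dim W"
  shows "dim V = dim U + dim W"
proof -
  have sub: "subspace U" "subspace W" "U \<inter> W = {0}"
    and V: "V = {u + w | u w. u \<in> U \<and> w \<in> W}"
    using assms(1) unfolding direct_sum_of_def by auto
  obtain A where A: "finite A" "A \<subseteq> U" "independent A" "U \<subseteq> span A" "card A = dim U"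
    using finite_dim_basis[OF assms(2)] by metis
  obtain B where B: "finite B" "B \<subseteq> W" "independent B" "W \<subseteq> span B" "card B = dim W"
    using finite_dim_basis[OF assms(3)] by metis
  have ind: "independent (A \<union> B)"
    using independent_Un_complementary[OF sub A(2) B(2) A(3) B(3)] .
  have "0 \<notin> A"
    using A(3) dependent_zero by blast
  moreover have "A \<inter> B \<subseteq> {0}"
    using Int_mono[OF A(2) B(2)] sub(3) by simp
  ultimately have "A \<inter> B = {}"
    by blast
  then have card: "card (A \<union> B) = dim U + dim W"
    using A(1,5) B(1,5) by (simp add: card_Un_disjoint)
  have "A \<union> B \<subseteq> V"
  proof
    fix x assume "x \<in> A \<union> B"
    then have "(x \<in> U \<and> 0 \<in> W) \<or> (0 \<in> U \<and> x \<in> W)"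
      using A(2) B(2) sub(1,2) subspace_0 by blast
    then show "x \<in> V"
      unfolding V by force
  qed
  then show ?thesis
    using dim_unique[OF _ _ ind card] sum_subset_span_Un[OF A(4) B(4)] unfolding V by blast
qed

section \<open>Growth spaces\<close>

lemma bracket_zero_left: "bracket 0 y = 0"
  using bracket_add_left[of 0 0 y] by simp

lemma bracket_zero_right: "bracket x 0 = 0"
  using bracket_add_right[of x 0 0] by simp

lemma bracket_skew: "bracket y x = - bracket x y"
proof -
  have "bracket x y + bracket y x = bracket (x + y) (x + y)"
    unfolding bracket_add_left bracket_add_right by (simp add: bracket_self)
  then show ?thesis
    by (simp add: bracket_self eq_neg_iff_add_eq_0 add.commute)
qed

lemma bracket_derivation: "bracket h (bracket x y) = bracket (bracket h x) y + bracket x (bracket h y)"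
proof -
  have "bracket y (bracket h x) = - bracket (bracket h x) y"
    by (rule bracket_skew)
  moreover have "bracket x (bracket y h) = - bracket x (bracket h y)"
  proof -
    have "bracket x (bracket y h) + bracket x (bracket h y) = 0"
      using bracket_add_right[of x "bracket y h" "bracket h y"] bracket_skew[of y h]
      by (simp add: bracket_zero_right)
    then show ?thesis
      by (simp add: eq_neg_iff_add_eq_0)
  qed
  ultimately have "bracket h (bracket x y) + - bracket x (bracket h y) + - bracket (bracket h x) y = 0"
    using jacobi[of h x y] by simp
  then show ?thesis
    by (simp add: algebra_simps)
qed

lemma bracket_in_subspace_left:
  assumes "x \<in> span A" "subspace W" "\<And>a. a \<in> A \<Longrightarrow> bracket a y \<in> W"
  shows "bracket x y \<in> W"
  using assms(1)
proof (induction rule: span_induct_alt)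
  case base
  then show ?case
    using assms(2) by (simp add: bracket_zero_left subspace_0)
next
  case (step c a x)
  then show ?case
    using assms(2,3) by (simp add: bracket_add_left bracket_scale_left subspace_add subspace_scale)
qed

lemma bracket_in_subspace_right:
  assumes "y \<in> span B" "subspace W" "\<And>b. b \<in> B \<Longrightarrow> bracket x b \<in> W"
  shows "bracket x y \<in> W"
  using assms(1)
proof (induction rule: span_induct_alt)
  case base
  then show ?case
    using assms(2) by (simp add: bracket_zero_right subspace_0)
next
  case (step c b y)
  then show ?case
    using assms(2,3) by (simp add: bracket_add_right bracket_scale_right subspace_add subspace_scale)
qed

lemma bracket_in_subspace_span:
  assumes "x \<in> span A" "y \<in> span B" "subspace W"
    and "\<And>a b. a \<in> A \<Longrightarrow> b \<in> B \<Longrightarrow> bracket a b \<in> W"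
  shows "bracket x y \<in> W"
  using assms by (blast intro: bracket_in_subspace_left bracket_in_subspace_right)

lemma lie_product_length_pos: "lie_product S m x \<Longrightarrow> 1 \<le> m"
  by (induction rule: lie_product.induct) auto

lemma lie_product_mono: "lie_product S m x \<Longrightarrow> S \<subseteq> T \<Longrightarrow> lie_product T m x"
  by (induction rule: lie_product.induct) (blast intro: lie_product.intros)+

lemma lie_product_in_generated_subalgebra:
  assumes "lie_product S m x"
  shows "x \<in> generated_subalgebra S"
  using assms unfolding generated_subalgebra_def hull_def
  by (induction rule: lie_product.induct) (auto simp: subalgebra_def)

lemma subspace_growth_space: "subspace (growth_space S n)"
  unfolding growth_space_def by (rule subspace_span)

lemma lie_product_in_growth_space: "lie_product S m x \<Longrightarrow> m \<le> n \<Longrightarrow> x \<in> growth_space S n"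
  unfolding growth_space_def by (blast intro: span_base)

lemma growth_space_mono: "m \<le> n \<Longrightarrow> growth_space S m \<subseteq> growth_space S n"
  unfolding growth_space_def by (rule span_mono) (auto dest: le_trans)

lemma growth_space_mono_generators: "S \<subseteq> T \<Longrightarrow> growth_space S n \<subseteq> growth_space T n"
  unfolding growth_space_def by (rule span_mono) (auto intro: lie_product_mono)

lemma growth_space_subset_generated_subalgebra: "growth_space S n \<subseteq> generated_subalgebra S"
proof -
  have "subspace (generated_subalgebra S)"
    unfolding generated_subalgebra_def hull_def by (rule subspace_Inter) (auto simp: subalgebra_def)
  then show ?thesis
    unfolding growth_space_def
    by (intro span_minimal) (auto intro: lie_product_in_generated_subalgebra)
qed

lemma bracket_growth_space:
  assumes "x \<in> growth_space S i" "y \<in> growth_space S j"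
  shows "bracket x y \<in> growth_space S (i + j)"
  using assms(1,2)[unfolded growth_space_def] subspace_growth_space
  by (rule bracket_in_subspace_span) (auto intro: lie_product_in_growth_space lie_product.product)

text \<open>By bilinearity the products of length \<open>m\<close> are spanned by the products of basis elements,
  and there are finitely many ways to split \<open>m\<close> into two shorter lengths.\<close>

lemma finite_dim_lie_products:
  assumes "finite_dim S"
  shows "finite_dim {x. lie_product S m x}"
proof (induction m rule: less_induct)
  case (less m)
  obtain B where B: "finite B" "S \<subseteq> span B"
    using assms unfolding finite_dim_def by blast
  have "\<forall>k. \<exists>F. k < m \<longrightarrow> finite F \<and> {x. lie_product S k x} \<subseteq> span F"
    using less unfolding finite_dim_def by blast
  then obtain F where F: "\<And>k. k < m \<Longrightarrow> finite (F k) \<and> {x. lie_product S k x} \<subseteq> span (F k)"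
    by metis
  define G where "G = B \<union> (\<Union>i<m. \<Union>j<m. (\<lambda>(a, b). bracket a b) ` (F i \<times> F j))"
  have "finite G"
    unfolding G_def using B(1) F by auto
  moreover have "x \<in> span G" if "lie_product S m x" for x
    using that
  proof cases
    case generator
    then show ?thesis
      using B(2) span_mono[of B G] unfolding G_def by blast
  next
    case (product i y j z)
    then have ij: "i < m" "j < m"
      using lie_product_length_pos[of S i y] lie_product_length_pos[of S j z] by auto
    have "y \<in> span (F i)" "z \<in> span (F j)"
      using product F[OF ij(1)] F[OF ij(2)] by auto
    moreover have "bracket a b \<in> span G" if "a \<in> F i" "b \<in> F j" for a b
      unfolding G_def using that ij by (intro span_base) force
    ultimately show ?thesis
      using product bracket_in_subspace_span[OF _ _ subspace_span] by metis
  qed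
  ultimately show ?case
    unfolding finite_dim_def by blast
qed

lemma finite_dim_growth_space:
  assumes "finite_dim S"
  shows "finite_dim (growth_space S n)"
proof -
  obtain F where F: "\<And>m. finite (F m) \<and> {x. lie_product S m x} \<subseteq> span (F m)"
    using finite_dim_lie_products[OF assms] unfolding finite_dim_def by metis
  have "growth_space S n \<subseteq> span (\<Union>m\<le>n. F m)"
    unfolding growth_space_def
  proof (rule span_minimal)
    show "{x. \<exists>m\<le>n. lie_product S m x} \<subseteq> span (\<Union>m\<le>n. F m)"
    proof safe
      fix x m assume "m \<le> n" "lie_product S m x"
      then have "x \<in> span (F m)" "F m \<subseteq> (\<Union>m\<le>n. F m)"
        using F by auto
      then show "x \<in> span (\<Union>m\<le>n. F m)"
        using span_mono by blast
    qed
  qed (rule subspace_span)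
  then show ?thesis
    unfolding finite_dim_def using F by (intro exI[of _ "\<Union>m\<le>n. F m"]) auto
qed

section \<open>Adjoining a subalgebra that acts on the generators\<close>

text \<open>A derivation acts on a product by the Leibniz rule, one factor at a time; if it preserves the
  set of generators, every term has the same length as the product.\<close>

lemma growth_space_ad_invariant:
  assumes "ad_invariant H M"
  shows "ad_invariant H (growth_space M n)"
proof -
  have product: "bracket h x \<in> growth_space M m" if "lie_product M m x" "h \<in> H" for h m x
    using that
  proof (induction rule: lie_product.induct)
    case (generator x)
    then show ?case
      using assms unfolding ad_invariant_def
      by (blast intro: lie_product_in_growth_space lie_product.generator)
  next
    case (product i x j y)
    have "bracket (bracket h x) y \<in> growth_space M (i + j)"
      using bracket_growth_space product.IH(1)[OF product.prems]
        lie_product_in_growth_space[OF product.hyps(2) order_refl] by blast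
    moreover have "bracket x (bracket h y) \<in> growth_space M (i + j)"
      using bracket_growth_space product.IH(2)[OF product.prems]
        lie_product_in_growth_space[OF product.hyps(1) order_refl] by blast
    ultimately show ?case
      using bracket_derivation[of h x y] subspace_growth_space subspace_add by metis
  qed
  have "bracket h x \<in> growth_space M n" if "h \<in> H" "x \<in> growth_space M n" for h x
    using that(2)[unfolded growth_space_def] subspace_growth_space
  proof (rule bracket_in_subspace_right)
    fix b assume "b \<in> {x. \<exists>m\<le>n. lie_product M m x}"
    then show "bracket h b \<in> growth_space M n"
      using product[OF _ that(1)] growth_space_mono by blast
  qed
  then show ?thesis
    unfolding ad_invariant_def by blast
qed

lemma lie_product_sum_decomposition:
  assumes "lie_product {h + x | h x. h \<in> H \<and> x \<in> M} n z"
    and "abelian_subalgebra H" "ad_invariant H M"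
  shows "\<exists>h\<in>H. \<exists>x\<in>growth_space M n. z = h + x"
  using assms(1)
proof (induction rule: lie_product.induct)
  case (generator z)
  then show ?case
    by (blast intro: lie_product_in_growth_space lie_product.generator)
next
  case (product i y j z)
  obtain h x where y: "h \<in> H" "x \<in> growth_space M i" "y = h + x"
    using product.IH(1) by blast
  obtain h' x' where z: "h' \<in> H" "x' \<in> growth_space M j" "z = h' + x'"
    using product.IH(2) by blast
  have inv: "bracket k w \<in> growth_space M (i + j)"
    if "k \<in> H" "w \<in> growth_space M m" "m \<le> i + j" for k w m
    using that growth_space_ad_invariant[OF assms(3), of m] growth_space_mono[of m "i + j" M]
    unfolding ad_invariant_def by blast
  have "bracket h x' \<in> growth_space M (i + j)"
    using inv[OF y(1) z(2)] by simp
  moreover have "bracket x h' \<in> growth_space M (i + j)"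
    using inv[OF z(1) y(2)] bracket_skew[of x h'] subspace_neg[OF subspace_growth_space] by auto
  moreover have "bracket x x' \<in> growth_space M (i + j)"
    using bracket_growth_space[OF y(2) z(2)] .
  ultimately have "bracket h x' + bracket x h' + bracket x x' \<in> growth_space M (i + j)"
    by (intro subspace_add[OF subspace_growth_space])
  moreover have "bracket y z = 0 + (bracket h x' + bracket x h' + bracket x x')"
    using assms(2) y(1) z(1) unfolding y(3) z(3) bracket_add_left bracket_add_right abelian_subalgebra_def
    by (simp add: algebra_simps)
  moreover have "0 \<in> H"
    using assms(2) unfolding abelian_subalgebra_def subalgebra_def by (blast intro: subspace_0)
  ultimately show ?case
    by metis
qed

text \<open>There are no products of length \<open>0\<close>, so \<open>growth_space V 0 = {0}\<close>, which contains \<open>H\<close> only if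
  \<open>H = {0}\<close>; hence the bound \<open>1 \<le> n\<close>.\<close>

lemma growth_space_direct_sum:
  assumes "direct_sum_of V H M" "abelian_subalgebra H" "ad_invariant H M" "1 \<le> n"
  shows "growth_space V n = {h + x | h x. h \<in> H \<and> x \<in> growth_space M n}"
proof (rule subset_antisym)
  have V: "V = {h + x | h x. h \<in> H \<and> x \<in> M}" and sub: "subspace H" "subspace M"
    using assms(1) unfolding direct_sum_of_def by auto
  have "subspace {h + x | h x. h \<in> H \<and> x \<in> growth_space M n}"
    using subspace_sums[OF sub(1) subspace_growth_space] .
  moreover have "z \<in> {h + x | h x. h \<in> H \<and> x \<in> growth_space M n}"
    if "lie_product V m z" "m \<le> n" for m z
    using lie_product_sum_decomposition[OF that(1)[unfolded V] assms(2,3)]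
      growth_space_mono[OF that(2), of M] by blast
  ultimately show "growth_space V n \<subseteq> {h + x | h x. h \<in> H \<and> x \<in> growth_space M n}"
    unfolding growth_space_def[of V] by (intro span_minimal) auto
  have "H \<subseteq> V"
    unfolding V using subspace_0[OF sub(2)] by force
  moreover have "M \<subseteq> V"
    unfolding V using subspace_0[OF sub(1)] by force
  ultimately have "H \<subseteq> growth_space V n" "growth_space M n \<subseteq> growth_space V n"
    using growth_space_mono_generators assms(4)
    by (blast intro: lie_product_in_growth_space lie_product.generator)+
  then show "{h + x | h x. h \<in> H \<and> x \<in> growth_space M n} \<subseteq> growth_space V n"
    using subspace_add[OF subspace_growth_space] by blast
qed

section \<open>Gelfand-Kirillov dimension under bounded changes of the growth\<close>

text \<open>For \<open>a > 0\<close> the additive bound gives the multiplicative one \<open>b \<le> a * (1 + d)\<close>. For \<open>a = 0\<close>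
  the convention \<open>ln 0 = 0\<close> makes the same constant work, since then \<open>b \<le> d\<close>.\<close>

lemma ln_of_nat_perturbation:
  fixes a b d :: nat
  assumes "a \<le> b" "b \<le> a + d"
  shows "\<bar>ln (real b) - ln (real a)\<bar> \<le> ln (1 + real d)"
proof (cases "a = 0")
  case True
  then show ?thesis
    using assms by (cases "b = 0") auto
next
  case False
  have "real b \<le> real a + real d"
    using assms(2) by linarith
  also have "\<dots> \<le> real a * (1 + real d)"
    using False mult_right_mono[of 1 "real a" "real d"] by (simp add: algebra_simps)
  finally have "ln (real b) \<le> ln (real a * (1 + real d))"
    using False assms(1) by (subst ln_le_cancel_iff) auto
  also have "\<dots> = ln (real a) + ln (1 + real d)"
    using False by (subst ln_mult) auto
  finally have "ln (real b) \<le> ln (real a) + ln (1 + real d)" .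
  moreover have "ln (real a) \<le> ln (real b)"
    using False assms(1) by (subst ln_le_cancel_iff) auto
  ultimately show ?thesis
    by simp
qed

lemma gk_dim_bounded_perturbation:
  assumes "\<And>n. 1 \<le> n \<Longrightarrow> growth S n \<le> growth T n"
    and "\<And>n. 1 \<le> n \<Longrightarrow> growth T n \<le> growth S n + d"
  shows "gk_dim T = gk_dim S"
proof -
  define u where "u n = (ln (real (growth T n)) - ln (real (growth S n))) / ln (real n)" for n
  define v where "v n = ln (real (growth S n)) / ln (real n)" for n
  have "(\<lambda>n. ln (1 + real d) / ln (real n)) \<longlonglongrightarrow> 0"
    by (intro tendsto_divide_0[OF tendsto_const] filterlim_at_top_imp_at_infinity
        filterlim_compose[OF ln_at_top filterlim_real_sequentially])
  moreover have "\<forall>\<^sub>F n in sequentially. norm (u n) \<le> ln (1 + real d) / ln (real n)"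
    using eventually_ge_at_top[of 1]
  proof eventually_elim
    case (elim n)
    then show ?case
      using ln_of_nat_perturbation[OF assms(1,2)] unfolding u_def
      by (auto simp: abs_divide intro!: divide_right_mono)
  qed
  ultimately have "u \<longlonglongrightarrow> 0"
    by (rule Lim_null_comparison[rotated])
  then have "(\<lambda>n. ereal (u n)) \<longlonglongrightarrow> 0"
    by (simp add: zero_ereal_def)
  then have "limsup (\<lambda>n. ereal (u n) + ereal (v n)) = 0 + limsup (\<lambda>n. ereal (v n))"
    by (rule ereal_limsup_lim_add) simp
  moreover have "u n + v n = ln (real (growth T n)) / ln (real n)" for n
    unfolding u_def v_def by (simp add: diff_divide_distrib)
  ultimately show ?thesis
    unfolding gk_dim_def by (simp add: v_def)
qed

end

theorem lemma6p1:
  fixes scale :: "'k::real_normed_field \<Rightarrow> 'a::ab_group_add \<Rightarrow> 'a"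
    and bracket :: "'a \<Rightarrow> 'a \<Rightarrow> 'a"
    and g0 g1 V1 g :: "'a set"
  assumes "lie_algebra scale bracket"
    and "lie_algebra.direct_sum_of scale V1 g0 g1"
    and "lie_algebra.finite_dim scale V1"
    and "lie_algebra.generated_subalgebra scale bracket V1 = UNIV"
    and "lie_algebra.abelian_subalgebra scale bracket g0"
    and "lie_algebra.ad_invariant bracket g0 g1"
    and "lie_algebra.diagonalizable_module scale bracket g0 g1"
    and "\<And>\<alpha>. lie_algebra.is_weight scale bracket g0 g1 \<alpha> \<Longrightarrow> \<exists>h\<in>g0. \<alpha> h \<noteq> 0"
    and "g = lie_algebra.generated_subalgebra scale bracket g1"
  shows "(g0 \<inter> g = {0} \<longrightarrow>
            (\<forall>n\<ge>1. lie_algebra.growth scale bracket V1 n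
                  = lie_algebra.growth scale bracket g1 n + vector_space.dim scale g0))
       \<and> lie_algebra.gk_dim scale bracket V1 = lie_algebra.gk_dim scale bracket g1"
proof -
  interpret lie_algebra scale bracket
    by (fact assms(1))
  have sub: "subspace g0" "subspace g1"
    and V1: "V1 = {h + x | h x. h \<in> g0 \<and> x \<in> g1}"
    using assms(2) unfolding direct_sum_of_def by auto
  have "g0 \<subseteq> V1"
    unfolding V1 using subspace_0[OF sub(2)] by force
  then have fin0: "finite_dim g0"
    using assms(3) finite_dim_subset by blast
  have "g1 \<subseteq> V1"
    unfolding V1 using subspace_0[OF sub(1)] by force
  then have fin: "finite_dim (growth_space g1 n)" for n
    using assms(3) finite_dim_subset finite_dim_growth_space by blast
  note sum = growth_space_direct_sum[OF assms(2,5,6)]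
  have "growth V1 n = growth g1 n + dim g0" if "g0 \<inter> g = {0}" "1 \<le> n" for n
  proof -
    have "g0 \<inter> growth_space g1 n = {0}"
      using that(1) growth_space_subset_generated_subalgebra[of g1 n] subspace_0[OF sub(1)]
        subspace_0[OF subspace_growth_space[of g1 n]] unfolding assms(9) by blast
    then have "direct_sum_of (growth_space V1 n) g0 (growth_space g1 n)"
      unfolding direct_sum_of_def using sub(1) subspace_growth_space sum[OF that(2)] by simp
    then show ?thesis
      unfolding growth_def using dim_direct_sum[OF _ fin0 fin] by simp
  qed
  moreover have "gk_dim V1 = gk_dim g1"
  proof (rule gk_dim_bounded_perturbation)
    show "growth g1 n \<le> growth V1 n" for n
      unfolding growth_def
      using dim_mono_finite_dim finite_dim_growth_space[OF assms(3)]
        growth_space_mono_generators[OF \<open>g1 \<subseteq> V1\<close>] by blast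
    show "growth V1 n \<le> growth g1 n + dim g0" if "1 \<le> n" for n
      unfolding growth_def sum[OF that] using dim_sum_le[OF fin0 fin] by (simp add: add.commute)
  qed
  ultimately show ?thesis
    by simp
qed

end
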